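(* Let $G=(V,E)$ be a finite graph with coupling constants $J:E\to[0,\infty)$, and let $g:V\to[-\infty,\infty]$. Then for any $u,v\in V$, $$\langle\sigma_u\sigma_v\rangle_g-\langle\sigma_u\rangle_g\langle\sigma_v\rangle_g\le\langle\sigma_u\sigma_v\rangle_0,$$ where $\langle\cdot\rangle_0$ is the expectation for the Ising model with identically zero external field.
   Context: For a finite undirected graph $G=(V,E)$, write $u\sim v$ if $u,v\in V$ are connected by an edge. Given coupling constants $J:E\to[0,\infty)$ and an external field $f:V\to[-\infty,\infty]$, the Ising model on $G$ (the inverse temperature being absorbed into $J$, i.e. $\beta=1$) is the probability measure on $\{\pm1\}^V$ $$\mu_f(\sigma)=\frac1{Z_f}\exp\Big\{\sum_{u\sim v}J_{uv}\sigma_u\sigma_v+\sum_{u\in V}f_u\sigma_u\Big\},$$ where the first sum is over edges and $Z_f$ is the normalizing constant. If $f_u=+\infty$ (resp. $-\infty$) at some vertices $u$, this is understood as forcing $\sigma_u=+1$ (resp. $\sigma_u=-1$): $\mu_f$ is supported on configurations satisfying these constraints, with weight proportional to the exponential above where the field sum runs only over vertices with finite $f_u$. The expectation with respect to $\mu_f$ is denoted $\langle\cdot\rangle_f$. *)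

theory Defs
  imports "HOL-Probability.Probability"
begin

definition finite_simple_graph :: "'a set \<Rightarrow> 'a set set \<Rightarrow> bool" where
  "finite_simple_graph V E \<longleftrightarrow> finite V \<and> (\<forall>e\<in>E. e \<subseteq> V \<and> card e = 2)"

definition configs :: "'a set \<Rightarrow> ('a \<Rightarrow> real) set" where
  "configs V = V \<rightarrow>\<^sub>E {-1, 1}"

definition admissible :: "'a set \<Rightarrow> ('a \<Rightarrow> ereal) \<Rightarrow> ('a \<Rightarrow> real) \<Rightarrow> bool" where
  "admissible V f \<sigma> \<longleftrightarrow>
     (\<forall>u\<in>V. (f u = \<infinity> \<longrightarrow> \<sigma> u = 1) \<and> (f u = -\<infinity> \<longrightarrow> \<sigma> u = -1))"

text \<open>
  As an edge is a two-element set \<open>{u, v}\<close>, the product of the spins over it is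
  \<open>\<sigma> u * \<sigma> v\<close>. The field term ranges over the vertices with finite field only;
  the infinite values act through \<^const>\<open>admissible\<close>.
\<close>

definition ising_exponent ::
  "'a set \<Rightarrow> 'a set set \<Rightarrow> ('a set \<Rightarrow> real) \<Rightarrow> ('a \<Rightarrow> ereal) \<Rightarrow> ('a \<Rightarrow> real) \<Rightarrow> real" where
  "ising_exponent V E J f \<sigma> =
     (\<Sum>e\<in>E. J e * (\<Prod>x\<in>e. \<sigma> x))
     + (\<Sum>u\<in>{u\<in>V. \<bar>f u\<bar> \<noteq> \<infinity>}. real_of_ereal (f u) * \<sigma> u)"

definition ising_weight ::
  "'a set \<Rightarrow> 'a set set \<Rightarrow> ('a set \<Rightarrow> real) \<Rightarrow> ('a \<Rightarrow> ereal) \<Rightarrow> ('a \<Rightarrow> real) \<Rightarrow> real" where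
  "ising_weight V E J f \<sigma> =
     (if admissible V f \<sigma> then exp (ising_exponent V E J f \<sigma>) else 0)"

definition partition_function ::
  "'a set \<Rightarrow> 'a set set \<Rightarrow> ('a set \<Rightarrow> real) \<Rightarrow> ('a \<Rightarrow> ereal) \<Rightarrow> real" where
  "partition_function V E J f = (\<Sum>\<sigma>\<in>configs V. ising_weight V E J f \<sigma>)"

definition ising_measure ::
  "'a set \<Rightarrow> 'a set set \<Rightarrow> ('a set \<Rightarrow> real) \<Rightarrow> ('a \<Rightarrow> ereal) \<Rightarrow> ('a \<Rightarrow> real) measure" where
  "ising_measure V E J f =
     point_measure (configs V)
       (\<lambda>\<sigma>. ennreal (ising_weight V E J f \<sigma> / partition_function V E J f))"

definition ising_expectation ::
  "'a set \<Rightarrow> 'a set set \<Rightarrow> ('a set \<Rightarrow> real) \<Rightarrow> ('a \<Rightarrow> ereal) \<Rightarrow> (('a \<Rightarrow> real) \<Rightarrow> real) \<Rightarrow> real" where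
  "ising_expectation V E J f X = (\<integral>\<sigma>. X \<sigma> \<partial>ising_measure V E J f)"

lemma finite_configs: "finite V \<Longrightarrow> finite (configs V)"
  by (simp add: configs_def finite_PiE)

lemma ising_weight_nonneg: "0 \<le> ising_weight V E J f \<sigma>"
  by (simp add: ising_weight_def)

lemma partition_function_pos:
  assumes "finite V"
  shows "0 < partition_function V E J f"
proof -
  define \<tau> :: "'a \<Rightarrow> real" where "\<tau> = (\<lambda>u\<in>V. if f u = -\<infinity> then -1 else 1)"
  have "\<tau> \<in> configs V"
    by (auto simp: \<tau>_def configs_def)
  moreover have "0 < ising_weight V E J f \<tau>"
    by (simp add: ising_weight_def admissible_def \<tau>_def)
  ultimately show ?thesis
    unfolding partition_function_def
    using finite_configs[OF assms] ising_weight_nonneg by (intro sum_pos2) auto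
qed

lemma prob_space_ising_measure:
  assumes "finite V"
  shows "prob_space (ising_measure V E J f)"
proof (rule prob_spaceI)
  let ?Z = "partition_function V E J f"
  have "emeasure (ising_measure V E J f) (space (ising_measure V E J f))
      = (\<Sum>\<sigma>\<in>configs V. ennreal (ising_weight V E J f \<sigma> / ?Z))"
    by (simp add: ising_measure_def space_point_measure emeasure_point_measure_finite
        finite_configs[OF assms])
  also have "\<dots> = ennreal (\<Sum>\<sigma>\<in>configs V. ising_weight V E J f \<sigma> / ?Z)"
    using partition_function_pos[OF assms, of E J f]
    by (intro sum_ennreal) (simp add: ising_weight_nonneg)
  also have "(\<Sum>\<sigma>\<in>configs V. ising_weight V E J f \<sigma> / ?Z) = 1"
    using partition_function_pos[OF assms, of E J f]
    by (simp add: sum_divide_distrib[symmetric] partition_function_def[symmetric])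
  finally show "emeasure (ising_measure V E J f) (space (ising_measure V E J f)) = 1"
    by simp
qed

lemma ising_expectation_eq_sum:
  assumes "finite V"
  shows "ising_expectation V E J f X =
    (\<Sum>\<sigma>\<in>configs V. ising_weight V E J f \<sigma> * X \<sigma>) / partition_function V E J f"
  using partition_function_pos[OF assms, of E J f]
  by (simp add: ising_expectation_def ising_measure_def ising_weight_nonneg
      lebesgue_integral_point_measure_finite finite_configs[OF assms] sum_divide_distrib)

end

theory Submission
  imports Defs "HOL-Real_Asymp.Real_Asymp"
begin

text \<open>
  Summing out the spins at \<open>u\<close> and \<open>v\<close>, and bounding the truncated correlation by AM-GM, reduces the
  claim for finite fields to the following inequality between partition functions on
  \<open>W = V - {u, v}\<close>, with \<open>k = J\<^sub>u\<close> and \<open>l = J\<^sub>v\<close> nonnegative fields and \<open>g\<close> an arbitrary one: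
  \<open>Z(g+k+l) Z(g-k-l) Z(k-l)\<^sup>2 \<le> Z(g+k-l) Z(g-k+l) Z(k+l)\<^sup>2\<close>.
  It is proved by induction on the size of \<open>W\<close>, raising \<open>k\<close> from zero one site at a time. While \<open>k\<^sub>x\<close>
  grows, consider the logarithm of the ratio of the two sides, minimised also over \<open>g\<^sub>x\<close>. At a
  minimum its derivative in \<open>g\<^sub>x\<close> vanishes, and then the induction hypothesis on \<open>W - {x}\<close>, applied
  once with \<open>k + J\<^sub>x, l\<close> and once with \<open>k + l, J\<^sub>x\<close>, shows that where the ratio is below one its
  derivative in \<open>k\<^sub>x\<close> is nonnegative, so the ratio never drops below one. Infinite fields are limits
  of finite ones.
\<close>

section \<open>Real inequalities behind raising the field at one site\<close>

text \<open>This yields the sign of the derivative in \<open>k\<^sub>x\<close> at a minimum, with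
  \<open>a, b, c, d\<close> one-site probabilities in four replicas. Equal differences turn
  \<open>(a + b)\<^sup>2 - (c + d)\<^sup>2\<close> into \<open>4 * (a * b - c * d)\<close>, and
  AM-GM bounds the sums from below.\<close>

lemma sum_diff_le_of_equal_difference:
  fixes a b c d s t :: real
  assumes "0 < a" "a < 1" "0 < b" "b < 1" "0 < c" "0 < d"
    and t: "0 < t" "t \<le> s" "s < 1"
    and diff: "a - b = c - d"
    and AB: "a * b * t\<^sup>2 \<le> c * d * s\<^sup>2"
    and AD: "a * b * (1 - s)\<^sup>2 \<le> (1 - a) * (1 - b) * s\<^sup>2"
  shows "a + b - (c + d) \<le> 2 * (s - t)"
proof (cases "a + b \<le> c + d")
  case True
  with t show ?thesis by simp
next
  case False
  \<comment> \<open>With \<open>a * b = (r * s)\<^sup>2\<close>, the hypotheses \<open>AB\<close>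
    and \<open>AD\<close> say that \<open>c * d\<close> and \<open>(1 - a) * (1 - b)\<close>
    dominate the squares of \<open>r * t\<close> and \<open>r * (1 - s)\<close>.\<close>
  define r where "r = sqrt (a * b) / s"
  have r0: "0 < r" using assms by (simp add: r_def)
  have rs: "(r * s)\<^sup>2 = a * b" using assms by (simp add: r_def)
  have amgm: "2 * x \<le> y + z" if "x\<^sup>2 \<le> y * z" "0 < y" "0 < z" for x y z :: real
  proof -
    have "(2 * x)\<^sup>2 \<le> (y + z)\<^sup>2"
      using that(1) sum_squares_ge_zero[of "y - z" 0] by (simp add: power2_eq_square algebra_simps)
    then show ?thesis using that by (meson add_nonneg_nonneg less_imp_le power2_le_imp_le)
  qed
  have S: "2 * (r * s) \<le> a + b" using rs assms by (intro amgm) auto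
  have "(r * t)\<^sup>2 \<le> c * d"
  proof -
    have "(r * t)\<^sup>2 * s\<^sup>2 = a * b * t\<^sup>2"
      by (simp add: rs[symmetric] power_mult_distrib)
    with AB have "(r * t)\<^sup>2 * s\<^sup>2 \<le> c * d * s\<^sup>2" by simp
    then show ?thesis using t by simp
  qed
  then have S': "2 * (r * t) \<le> c + d" using assms by (intro amgm) auto
  have "(r * (1 - s))\<^sup>2 \<le> (1 - a) * (1 - b)"
  proof -
    have "(r * (1 - s))\<^sup>2 * s\<^sup>2 = a * b * (1 - s)\<^sup>2"
      by (simp add: rs[symmetric] power_mult_distrib)
    with AD have "(r * (1 - s))\<^sup>2 * s\<^sup>2 \<le> (1 - a) * (1 - b) * s\<^sup>2" by simp
    then show ?thesis using t by simp
  qed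
  then have "2 * (r * (1 - s)) \<le> (1 - a) + (1 - b)" using assms by (intro amgm) auto
  \<comment> \<open>The two AM-GM bounds add up to \<open>2 * r \<le> 2\<close>.\<close>
  with S have r1: "r \<le> 1" by (simp add: algebra_simps)
  have "(a + b - (c + d)) * (a + b + (c + d)) = (a + b)\<^sup>2 - (c + d)\<^sup>2"
    by (simp add: power2_eq_square algebra_simps)
  also have "\<dots> = 4 * (a * b) - 4 * (c * d)"
  proof -
    have "(a - b)\<^sup>2 = (c - d)\<^sup>2" using diff by simp
    then show ?thesis by (simp add: power2_eq_square algebra_simps)
  qed
  also have "\<dots> \<le> 4 * (r * s)\<^sup>2 - 4 * (r * t)\<^sup>2"
    using rs \<open>(r * t)\<^sup>2 \<le> c * d\<close> by simp
  also have "\<dots> = (2 * r * (s - t)) * (2 * (r * s) + 2 * (r * t))"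
    by (simp add: power2_eq_square algebra_simps)
  also have "\<dots> \<le> (2 * r * (s - t)) * (a + b + (c + d))"
    using S S' r0 t by (intro mult_left_mono) auto
  finally have "a + b - (c + d) \<le> 2 * r * (s - t)"
    using assms by (simp add: mult_le_cancel_right)
  also have "\<dots> \<le> 2 * (s - t)"
    using mult_right_mono[OF r1, of "s - t"] t by simp
  finally show ?thesis .
qed

text \<open>
  Here \<open>p\<^sub>i\<close>, \<open>q\<^sub>i\<close> are the contributions of \<open>\<sigma>\<^sub>x = 1\<close> and \<open>\<sigma>\<^sub>x = -1\<close> to the four partition functions with
  field \<open>g\<close>, at \<open>k\<^sub>x = 0\<close>; \<open>P\<close>, \<open>Q\<close> and \<open>P'\<close>, \<open>Q'\<close> are those for the fields \<open>k + l\<close> and \<open>k - l\<close>; and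
  \<open>\<kappa> = exp (2 * k\<^sub>x)\<close>. The hypothesis \<open>base\<close> is the inequality at \<open>k\<^sub>x = 0\<close> for every value of \<open>g\<^sub>x\<close>.
\<close>

lemma four_replica_edge:
  fixes p1 q1 p2 q2 p3 q3 p4 q4 P Q P' Q' \<kappa> :: real
  assumes pos: "0 < p1" "0 < q1" "0 < p2" "0 < q2" "0 < p3" "0 < q3" "0 < p4" "0 < q4"
      "0 < P" "0 < Q" "0 < P'" "0 < Q'"
    and base: "\<And>\<alpha> \<beta>. 0 < \<alpha> \<Longrightarrow> 0 < \<beta> \<Longrightarrow>
      (\<alpha> * p1 + \<beta> * q1) * (\<alpha> * p2 + \<beta> * q2) * (P' + Q')\<^sup>2
      \<le> (\<alpha> * p3 + \<beta> * q3) * (\<alpha> * p4 + \<beta> * q4) * (P + Q)\<^sup>2"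
    and AB: "p1 * q2 * P'\<^sup>2 \<le> p3 * q4 * P\<^sup>2"
    and AD: "p1 * q2 * Q\<^sup>2 \<le> q1 * p2 * P\<^sup>2"
    and PQ: "Q * P' \<le> P * Q'"
    and \<kappa>: "1 \<le> \<kappa>"
  shows "(\<kappa> * p1 + q1) * (p2 + \<kappa> * q2) * (\<kappa> * P' + Q')\<^sup>2
       \<le> (\<kappa> * p3 + q3) * (p4 + \<kappa> * q4) * (\<kappa> * P + Q)\<^sup>2"
proof (rule ccontr)
  assume neg: "\<not> ?thesis"
  \<comment> \<open>\<open>\<theta> = \<alpha> / (\<alpha> + \<beta>)\<close> compactifies the range of the field at \<open>x\<close> to \<open>[0, 1]\<close>.\<close>
  define L where "L = (\<lambda>k \<theta>.
      ln (k * \<theta> * p3 + (1 - \<theta>) * q3) + ln (\<theta> * p4 + k * (1 - \<theta>) * q4) + 2 * ln (k * P + Q)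
    - ln (k * \<theta> * p1 + (1 - \<theta>) * q1) - ln (\<theta> * p2 + k * (1 - \<theta>) * q2) - 2 * ln (k * P' + Q'))"
  have posk: "0 < k * \<theta> * p + (1 - \<theta>) * q" "0 < \<theta> * p + k * (1 - \<theta>) * q"
    if "1 \<le> k" "0 \<le> \<theta>" "\<theta> \<le> 1" "0 < p" "0 < q" for k \<theta> p q :: real
    using that by (cases "\<theta> = 0"; simp add: add_pos_nonneg)+
  have pos1: "0 < k * x + y" if "1 \<le> k" "0 < x" "0 < y" for k x y :: real
    using that by (intro add_pos_pos) auto
  have L_ln: "L k \<theta> = ln ((k * \<theta> * p3 + (1 - \<theta>) * q3) * (\<theta> * p4 + k * (1 - \<theta>) * q4) * (k * P + Q)\<^sup>2)
     - ln ((k * \<theta> * p1 + (1 - \<theta>) * q1) * (\<theta> * p2 + k * (1 - \<theta>) * q2) * (k * P' + Q')\<^sup>2)"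
    (is "_ = ln (?n * ?n' * ?N\<^sup>2) - ln (?d * ?d' * ?D\<^sup>2)")
    if "1 \<le> k" "0 \<le> \<theta>" "\<theta> \<le> 1" for k \<theta>
  proof -
    have "0 < ?n" "0 < ?n'" "0 < ?d" "0 < ?d'" "0 < ?N" "0 < ?D"
      using that pos posk pos1 by auto
    then show ?thesis by (simp add: L_def ln_mult ln_realpow)
  qed
  \<comment> \<open>\<open>L\<close> is the logarithm of right side over left side; at
    \<open>\<theta> = 1/2\<close> both fields at \<open>x\<close> have equal weight, and the factors
    \<open>1/2\<close> cancel, so this is the negated claim.\<close>
  have L_neg: "L \<kappa> (1/2) < 0"
  proof -
    have "(\<kappa> * (1/2) * p3 + (1 - 1/2) * q3) * ((1/2) * p4 + \<kappa> * (1 - 1/2) * q4) * (\<kappa> * P + Q)\<^sup>2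
      < (\<kappa> * (1/2) * p1 + (1 - 1/2) * q1) * ((1/2) * p2 + \<kappa> * (1 - 1/2) * q2) * (\<kappa> * P' + Q')\<^sup>2"
      using neg by (simp add: field_simps)
    moreover have "0 < (\<kappa> * (1/2) * p3 + (1 - 1/2) * q3) * ((1/2) * p4 + \<kappa> * (1 - 1/2) * q4) * (\<kappa> * P + Q)\<^sup>2"
      using \<kappa> pos by (intro mult_pos_pos zero_less_power add_pos_pos) auto
    ultimately show ?thesis using \<kappa> by (simp add: L_ln)
  qed
  have \<kappa>1: "1 < \<kappa>"
  proof (rule ccontr)
    assume "\<not> 1 < \<kappa>"
    with \<kappa> have "\<kappa> = 1" by simp
    with neg base[of 1 1] show False by simp
  qed
  \<comment> \<open>\<open>base\<close> requires both weights positive. The endpoints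
    \<open>\<theta> = 1\<close> and \<open>\<theta> = 0\<close> come from letting one weight tend to
    0 in a quadratic polynomial.\<close>
  have lim: "0 \<le> x" if "\<And>\<beta>. 0 < \<beta> \<Longrightarrow> 0 \<le> x + y * \<beta> + z * \<beta>\<^sup>2" for x y z :: real
  proof (rule tendsto_lowerbound)
    show "((\<lambda>\<beta>. x + y * \<beta> + z * \<beta>\<^sup>2) \<longlongrightarrow> x) (at_right 0)"
      by (auto intro!: tendsto_eq_intros)
    show "\<forall>\<^sub>F \<beta> in at_right 0. 0 \<le> x + y * \<beta> + z * \<beta>\<^sup>2"
      using that by (auto simp: eventually_at_filter)
  qed auto
  have base_p: "p1 * p2 * (P' + Q')\<^sup>2 \<le> p3 * p4 * (P + Q)\<^sup>2"
    using lim[of "p3 * p4 * (P + Q)\<^sup>2 - p1 * p2 * (P' + Q')\<^sup>2"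
        "(p3 * q4 + q3 * p4) * (P + Q)\<^sup>2 - (p1 * q2 + q1 * p2) * (P' + Q')\<^sup>2"
        "q3 * q4 * (P + Q)\<^sup>2 - q1 * q2 * (P' + Q')\<^sup>2"] base[of 1]
    by (simp add: algebra_simps power2_eq_square)
  have base_q: "q1 * q2 * (P' + Q')\<^sup>2 \<le> q3 * q4 * (P + Q)\<^sup>2"
    using lim[of "q3 * q4 * (P + Q)\<^sup>2 - q1 * q2 * (P' + Q')\<^sup>2"
        "(p3 * q4 + q3 * p4) * (P + Q)\<^sup>2 - (p1 * q2 + q1 * p2) * (P' + Q')\<^sup>2"
        "p3 * p4 * (P + Q)\<^sup>2 - p1 * p2 * (P' + Q')\<^sup>2"] base[of _ 1]
    by (simp add: algebra_simps power2_eq_square)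
  \<comment> \<open>By \<open>PQ\<close>, the quotient of \<open>k * P' + Q'\<close> by
    \<open>k * P + Q\<close> is at most its value at \<open>k = 1\<close>. Hence the endpoint
    inequalities carry over from \<open>k = 1\<close> to larger \<open>k\<close>.\<close>
  have ratio: "(k * P' + Q') * (P + Q) \<le> (k * P + Q) * (P' + Q')" if "1 \<le> k" for k
  proof -
    have "0 \<le> (k - 1) * (P * Q' - Q * P')" using that PQ by simp
    then show ?thesis by (simp add: algebra_simps)
  qed
  have scale: "x * (k * P' + Q')\<^sup>2 \<le> y * (k * P + Q)\<^sup>2"
    if "x * (P' + Q')\<^sup>2 \<le> y * (P + Q)\<^sup>2" "1 \<le> k" "0 < x" "0 < y" for x y k
  proof -
    have "x * (k * P' + Q')\<^sup>2 * (P + Q)\<^sup>2 = x * ((k * P' + Q') * (P + Q))\<^sup>2"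
      by (simp add: power_mult_distrib)
    also have "\<dots> \<le> x * ((k * P + Q) * (P' + Q'))\<^sup>2"
      using that ratio[of k] pos pos1[of k P' Q']
      by (intro mult_left_mono power_mono) auto
    also have "\<dots> = (x * (P' + Q')\<^sup>2) * (k * P + Q)\<^sup>2"
      by (simp add: power_mult_distrib)
    also have "\<dots> \<le> (y * (P + Q)\<^sup>2) * (k * P + Q)\<^sup>2"
      using that by (intro mult_right_mono) auto
    finally have "x * (k * P' + Q')\<^sup>2 * (P + Q)\<^sup>2 \<le> y * (k * P + Q)\<^sup>2 * (P + Q)\<^sup>2"
      by (simp add: mult_ac)
    moreover have "0 < (P + Q)\<^sup>2" using pos by (simp add: add_pos_pos)
    ultimately show ?thesis by (rule mult_right_le_imp_le)
  qed
  \<comment> \<open>At an endpoint each pair of linear factors collapses to one product times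
    \<open>k\<close>, and this \<open>k\<close> cancels.\<close>
  have L_one: "0 \<le> L k 1" if "1 \<le> k" for k
  proof -
    have "p1 * p2 * (k * P' + Q')\<^sup>2 \<le> p3 * p4 * (k * P + Q)\<^sup>2"
      using base_p that pos by (intro scale) auto
    then have "k * (p1 * p2 * (k * P' + Q')\<^sup>2) \<le> k * (p3 * p4 * (k * P + Q)\<^sup>2)"
      using that by (intro mult_left_mono) auto
    moreover have "0 < k * (p1 * p2 * (k * P' + Q')\<^sup>2)"
      using that pos pos1[of k P' Q'] by (intro mult_pos_pos zero_less_power) auto
    ultimately have "ln (k * (p1 * p2 * (k * P' + Q')\<^sup>2)) \<le> ln (k * (p3 * p4 * (k * P + Q)\<^sup>2))"
      by simp
    then show ?thesis using that by (simp add: L_ln mult_ac)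
  qed
  have L_zero: "0 \<le> L k 0" if "1 \<le> k" for k
  proof -
    have "q1 * q2 * (k * P' + Q')\<^sup>2 \<le> q3 * q4 * (k * P + Q)\<^sup>2"
      using base_q that pos by (intro scale) auto
    then have "k * (q1 * q2 * (k * P' + Q')\<^sup>2) \<le> k * (q3 * q4 * (k * P + Q)\<^sup>2)"
      using that by (intro mult_left_mono) auto
    moreover have "0 < k * (q1 * q2 * (k * P' + Q')\<^sup>2)"
      using that pos pos1[of k P' Q'] by (intro mult_pos_pos zero_less_power) auto
    ultimately have "ln (k * (q1 * q2 * (k * P' + Q')\<^sup>2)) \<le> ln (k * (q3 * q4 * (k * P + Q)\<^sup>2))"
      by simp
    then show ?thesis using that by (simp add: L_ln mult_ac)
  qed
  have L_base: "0 \<le> L 1 \<theta>" if "0 < \<theta>" "\<theta> < 1" for \<theta>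
    using base[of \<theta> "1 - \<theta>"] that pos by (simp add: L_ln add_pos_pos)
  \<comment> \<open>With this choice \<open>\<epsilon> * ln \<kappa>\<close> is half of
    \<open>- L \<kappa> (1/2)\<close>, which leaves the perturbed function negative there.\<close>
  define \<epsilon> where "\<epsilon> = - L \<kappa> (1/2) / (2 * ln \<kappa>)"
  have \<epsilon>: "0 < \<epsilon>" using L_neg \<kappa>1 by (simp add: \<epsilon>_def divide_neg_pos)
  \<comment> \<open>The extra term makes the derivative in \<open>k\<close> strictly positive at an interior minimum.\<close>
  define M where "M = (\<lambda>k \<theta>. L k \<theta> + \<epsilon> * ln k)"
  have M_neg: "M \<kappa> (1/2) < 0" using L_neg \<kappa>1 by (simp add: M_def \<epsilon>_def)
  have "continuous_on ({1..\<kappa>} \<times> {0..1}) (\<lambda>z. M (fst z) (snd z))"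
    unfolding M_def L_def
    apply (intro continuous_intros)
    using pos posk pos1 by (auto simp: less_imp_neq[symmetric] dest!: less_imp_neq)
  moreover have "compact ({1..\<kappa>} \<times> {0..1::real})" by (intro compact_Times compact_Icc)
  moreover have "{1..\<kappa>} \<times> {0..1::real} \<noteq> {}" using \<kappa> by auto
  ultimately obtain z where z: "z \<in> {1..\<kappa>} \<times> {0..1}"
    and zmin: "\<And>w. w \<in> {1..\<kappa>} \<times> {0..1} \<Longrightarrow> M (fst z) (snd z) \<le> M (fst w) (snd w)"
    using continuous_attains_inf[of "{1..\<kappa>} \<times> {0..1}" "\<lambda>z. M (fst z) (snd z)"] by blast
  obtain k \<theta> where [simp]: "z = (k, \<theta>)" by (cases z)
  have k: "1 \<le> k" "k \<le> \<kappa>" and \<theta>: "0 \<le> \<theta>" "\<theta> \<le> 1" using z by auto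
  have min: "M k \<theta> \<le> M k' \<theta>'" if "1 \<le> k'" "k' \<le> \<kappa>" "0 \<le> \<theta>'" "\<theta>' \<le> 1" for k' \<theta>'
    using zmin[of "(k', \<theta>')"] that by simp
  have Mk: "M k \<theta> < 0" using min[of \<kappa> "1/2"] M_neg \<kappa> by simp
  have lnk: "0 \<le> \<epsilon> * ln k" using \<epsilon> k by simp
  have Lk: "L k \<theta> < 0" using Mk lnk by (simp add: M_def)
  \<comment> \<open>A negative minimum cannot lie on the sides \<open>\<theta> = 0\<close>,
    \<open>\<theta> = 1\<close> or \<open>k = 1\<close>, where \<open>L\<close> is
    nonnegative.\<close>
  have \<theta>01: "0 < \<theta>" "\<theta> < 1"
    using Lk L_one[OF k(1)] L_zero[OF k(1)] \<theta> by (force simp: less_le)+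
  have k1: "1 < k" using Lk L_base[OF \<theta>01] k by (force simp: less_le)
  define f1 f2 f3 f4 where "f1 = k * \<theta> * p1 + (1 - \<theta>) * q1" "f2 = \<theta> * p2 + k * (1 - \<theta>) * q2"
    "f3 = k * \<theta> * p3 + (1 - \<theta>) * q3" "f4 = \<theta> * p4 + k * (1 - \<theta>) * q4"
  note f_defs = this
  define Z Z' where "Z = k * P + Q" "Z' = k * P' + Q'"
  note Z_defs = this
  have fpos: "0 < f1" "0 < f2" "0 < f3" "0 < f4" "0 < Z" "0 < Z'"
    using posk[OF k(1) \<theta>] pos1[OF k(1)] pos by (auto simp: f_defs Z_defs)
  \<comment> \<open>Each quantity is the share of the term carrying the factor \<open>k\<close>: the
    probability of spin 1 at \<open>x\<close> for \<open>u1\<close>, \<open>u3\<close>,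
    \<open>s\<close>, \<open>t\<close>, and of spin -1 for \<open>u2\<close>, \<open>u4\<close>. It
    is also \<open>k\<close> times the logarithmic derivative in \<open>k\<close> of its
    factor.\<close>
  define u1 u2 u3 u4 s t where "u1 = k * \<theta> * p1 / f1" "u2 = k * (1 - \<theta>) * q2 / f2"
    "u3 = k * \<theta> * p3 / f3" "u4 = k * (1 - \<theta>) * q4 / f4" "s = k * P / Z" "t = k * P' / Z'"
  note u_defs = this
  have comp: "1 - u1 = (1 - \<theta>) * q1 / f1" "1 - u2 = \<theta> * p2 / f2"
    "1 - u3 = (1 - \<theta>) * q3 / f3" "1 - u4 = \<theta> * p4 / f4" "1 - s = Q / Z" "1 - t = Q' / Z'"
    using fpos by (simp_all add: u_defs divide_simps) (simp_all add: f_defs Z_defs)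
  have upos: "0 < u1" "0 < u2" "0 < u3" "0 < u4" "0 < s" "0 < t"
    using fpos pos k1 \<theta>01 by (auto simp: u_defs)
  have "0 < 1 - u1" "0 < 1 - u2" "0 < 1 - u3" "0 < 1 - u4" "0 < 1 - s" "0 < 1 - t"
    unfolding comp using fpos pos k1 \<theta>01 by auto
  then have ult: "u1 < 1" "u2 < 1" "u3 < 1" "u4 < 1" "s < 1" "t < 1" by auto
  have d_ln: "((\<lambda>x. ln (F x)) has_real_derivative D / F z) (at z)"
    if "(F has_real_derivative D) (at z)" "0 < F z" for F D z
    using that by (auto intro!: derivative_eq_intros simp: divide_simps)
  have d\<theta>: "((\<lambda>x. ln (k * x * p + (1 - x) * q)) has_real_derivative
      (k * p - q) / (k * \<theta> * p + (1 - \<theta>) * q)) (at \<theta>)"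
      "((\<lambda>x. ln (x * p + k * (1 - x) * q)) has_real_derivative
      (p - k * q) / (\<theta> * p + k * (1 - \<theta>) * q)) (at \<theta>)"
    if "0 < p" "0 < q" for p q
    by (rule d_ln, auto intro!: derivative_eq_intros posk k \<theta> that)+
  have dk: "((\<lambda>x. ln (x * \<theta> * p + (1 - \<theta>) * q)) has_real_derivative
      \<theta> * p / (k * \<theta> * p + (1 - \<theta>) * q)) (at k)"
      "((\<lambda>x. ln (\<theta> * p + x * (1 - \<theta>) * q)) has_real_derivative
      (1 - \<theta>) * q / (\<theta> * p + k * (1 - \<theta>) * q)) (at k)"
    if "0 < p" "0 < q" for p q
    by (rule d_ln, auto intro!: derivative_eq_intros posk k \<theta> that)+
  have dk': "((\<lambda>x. ln (x * p + q)) has_real_derivative p / (k * p + q)) (at k)"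
    if "0 < p" "0 < q" for p q
    by (rule d_ln, auto intro!: derivative_eq_intros pos1 k that)
  have "((\<lambda>x. M k x) has_real_derivative
      (k * p3 - q3) / f3 + (p4 - k * q4) / f4 - (k * p1 - q1) / f1 - (p2 - k * q2) / f2) (at \<theta>)"
    unfolding M_def L_def f_defs
    by (rule DERIV_cong[OF DERIV_add[OF DERIV_diff[OF DERIV_diff[OF DERIV_diff[OF DERIV_add[OF
            DERIV_add[OF d\<theta>(1) d\<theta>(2)] DERIV_const] d\<theta>(1)] d\<theta>(2)] DERIV_const] DERIV_const]])
       (simp_all add: pos)
  then have "(k * p3 - q3) / f3 + (p4 - k * q4) / f4 - (k * p1 - q1) / f1 - (p2 - k * q2) / f2 = 0"
  proof (rule DERIV_local_min)
    show "0 < min \<theta> (1 - \<theta>)" using \<theta>01 by simp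
    show "\<forall>y. \<bar>\<theta> - y\<bar> < min \<theta> (1 - \<theta>) \<longrightarrow> M k \<theta> \<le> M k y"
      using k by (auto intro!: min)
  qed
  \<comment> \<open>In terms of these probabilities, stationarity in \<open>\<theta>\<close> becomes
    the equal-difference hypothesis.\<close>
  moreover have "(k * p3 - q3) / f3 = (u3 - \<theta>) / (\<theta> * (1 - \<theta>))"
      "(k * p1 - q1) / f1 = (u1 - \<theta>) / (\<theta> * (1 - \<theta>))"
      "(p4 - k * q4) / f4 = (1 - u4 - \<theta>) / (\<theta> * (1 - \<theta>))"
      "(p2 - k * q2) / f2 = (1 - u2 - \<theta>) / (\<theta> * (1 - \<theta>))"
    using fpos \<theta>01 by (simp_all add: u_defs divide_simps) (simp_all add: f_defs algebra_simps)
  ultimately have "((u3 - \<theta>) + (1 - u4 - \<theta>) - (u1 - \<theta>) - (1 - u2 - \<theta>)) / (\<theta> * (1 - \<theta>)) = 0"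
    by (simp only: add_divide_distrib diff_divide_distrib)
  then have diff: "u1 - u2 = u3 - u4" using \<theta>01 by simp
  have less: "f3 * f4 * Z\<^sup>2 < f1 * f2 * Z'\<^sup>2"
  proof -
    have "ln (f3 * f4 * Z\<^sup>2) < ln (f1 * f2 * Z'\<^sup>2)"
      using Lk L_ln[OF k(1) \<theta>] by (simp add: f_defs Z_defs)
    then show ?thesis using fpos by (simp add: ln_less_cancel_iff)
  qed
  have ts: "t \<le> s"
    using PQ k1 fpos pos by (simp add: u_defs divide_simps) (simp add: Z_defs algebra_simps)
  have "u1 * u2 * t\<^sup>2 \<le> u3 * u4 * s\<^sup>2"
  proof -
    define w where "w = k\<^sup>2 * (\<theta> * (1 - \<theta>)) * k\<^sup>2"
    have w: "0 \<le> w" using k1 \<theta>01 by (simp add: w_def)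
    have "u1 * u2 * t\<^sup>2 = w * (p1 * q2 * P'\<^sup>2) / (f1 * f2 * Z'\<^sup>2)"
      by (simp add: u_defs w_def power2_eq_square)
    also have "\<dots> \<le> w * (p3 * q4 * P\<^sup>2) / (f1 * f2 * Z'\<^sup>2)"
      using AB w fpos by (intro divide_right_mono mult_left_mono) auto
    \<comment> \<open>Here negativity of \<open>L\<close> enters: the denominator on the right is
      the smaller one.\<close>
    also have "\<dots> \<le> w * (p3 * q4 * P\<^sup>2) / (f3 * f4 * Z\<^sup>2)"
      using less w fpos pos by (intro divide_left_mono mult_nonneg_nonneg mult_pos_pos) auto
    also have "\<dots> = u3 * u4 * s\<^sup>2"
      by (simp add: u_defs w_def power2_eq_square)
    finally show ?thesis .
  qed
  moreover have "u1 * u2 * (1 - s)\<^sup>2 \<le> (1 - u1) * (1 - u2) * s\<^sup>2"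
  proof -
    define w where "w = k\<^sup>2 * (\<theta> * (1 - \<theta>))"
    have w: "0 \<le> w" using k1 \<theta>01 by (simp add: w_def)
    have "u1 * u2 * (1 - s)\<^sup>2 = w * (p1 * q2 * Q\<^sup>2) / (f1 * f2 * Z\<^sup>2)"
      unfolding comp by (simp add: u_defs w_def power2_eq_square)
    also have "\<dots> \<le> w * (q1 * p2 * P\<^sup>2) / (f1 * f2 * Z\<^sup>2)"
      using AD w fpos by (intro divide_right_mono mult_left_mono) auto
    also have "\<dots> = (1 - u1) * (1 - u2) * s\<^sup>2"
      unfolding comp by (simp add: u_defs w_def power2_eq_square)
    finally show ?thesis .
  qed
  ultimately have key: "u1 + u2 - (u3 + u4) \<le> 2 * (s - t)"
    using upos ult ts diff by (intro sum_diff_le_of_equal_difference) auto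
  have deriv: "((\<lambda>x. M x \<theta>) has_real_derivative
      \<theta> * p3 / f3 + (1 - \<theta>) * q4 / f4 + 2 * (P / Z) - \<theta> * p1 / f1 - (1 - \<theta>) * q2 / f2
      - 2 * (P' / Z') + \<epsilon> / k) (at k)"
    unfolding M_def L_def f_defs Z_defs
    by (rule DERIV_cong[OF DERIV_add[OF DERIV_diff[OF DERIV_diff[OF DERIV_diff[OF DERIV_add[OF
            DERIV_add[OF dk(1) dk(2)] DERIV_cmult[OF dk']] dk(1)] dk(2)] DERIV_cmult[OF dk']]
            DERIV_cmult[OF DERIV_ln]]])
       (use pos k1 in \<open>simp_all add: divide_inverse\<close>)
  have "\<theta> * p3 / f3 + (1 - \<theta>) * q4 / f4 + 2 * (P / Z) - \<theta> * p1 / f1 - (1 - \<theta>) * q2 / f2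
      - 2 * (P' / Z') + \<epsilon> / k = (u3 + u4 + 2 * s - u1 - u2 - 2 * t + \<epsilon>) / k"
    using k1 by (simp add: u_defs add_divide_distrib diff_divide_distrib)
  also have "\<dots> > 0" using key \<epsilon> k1 by simp
  finally obtain d where d: "0 < d" "\<And>h. 0 < h \<Longrightarrow> h < d \<Longrightarrow> M (k - h) \<theta> < M k \<theta>"
    using DERIV_pos_inc_left[OF deriv] by blast
  \<comment> \<open>A small step to the left stays in \<open>[1, \<kappa>]\<close>, even when
    \<open>k = \<kappa>\<close>, and lowers the minimum.\<close>
  define h where "h = min (d / 2) (k - 1)"
  have "0 < h" "h < d" "h \<le> k - 1" using d k1 by (auto simp: h_def)
  with d(2)[of h] min[of "k - h" \<theta>] k \<theta> show False by simp
qed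

section \<open>Partition functions with finite fields, and their recursion over vertices\<close>

text \<open>The value 0 off \<open>E\<close> makes the coupling to a fixed vertex a field on all
  other vertices.\<close>

definition edge_coupling :: "'a set set \<Rightarrow> ('a set \<Rightarrow> real) \<Rightarrow> 'a \<Rightarrow> 'a \<Rightarrow> real" where
  "edge_coupling E J x y = (if {x, y} \<in> E then J {x, y} else 0)"

text \<open>Keeping only edges inside \<open>W\<close> lets vertices be removed while
  \<open>E\<close> and \<open>J\<close> stay fixed.\<close>

definition energy ::
  "'a set set \<Rightarrow> ('a set \<Rightarrow> real) \<Rightarrow> 'a set \<Rightarrow> ('a \<Rightarrow> real) \<Rightarrow> ('a \<Rightarrow> real) \<Rightarrow> real" where
  "energy E J W f \<sigma> = (\<Sum>e\<in>{e\<in>E. e \<subseteq> W}. J e * (\<Prod>x\<in>e. \<sigma> x)) + (\<Sum>x\<in>W. f x * \<sigma> x)"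

definition finite_field_Z ::
  "'a set set \<Rightarrow> ('a set \<Rightarrow> real) \<Rightarrow> 'a set \<Rightarrow> ('a \<Rightarrow> real) \<Rightarrow> real" where
  "finite_field_Z E J W f = (\<Sum>\<sigma>\<in>configs W. exp (energy E J W f \<sigma>))"

lemma sum_configs_insert:
  assumes "finite W" "x \<notin> W"
  shows "(\<Sum>\<sigma>\<in>configs (insert x W). h \<sigma>) = (\<Sum>\<tau>\<in>configs W. h (\<tau>(x := 1)) + h (\<tau>(x := -1)))"
proof -
  have "(\<Sum>\<sigma>\<in>configs (insert x W). h \<sigma>)
      = (\<Sum>(s, \<tau>)\<in>{-1, 1} \<times> configs W. h (\<tau>(x := s)))"
  proof (rule sum.reindex_bij_betw[symmetric, where h = "\<lambda>(s, \<tau>). \<tau>(x := s)", unfolded case_prod_unfold, THEN trans])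
    show "bij_betw (\<lambda>p. (snd p)(x := fst p)) ({-1, 1} \<times> configs W) (configs (insert x W))"
      unfolding configs_def bij_betw_def PiE_insert_eq
      using inj_combinator[OF assms(2), of "\<lambda>_. {-1, 1::real}"]
      by (simp add: case_prod_unfold)
  qed (simp add: case_prod_unfold)
  also have "\<dots> = (\<Sum>s\<in>{-1, 1}. \<Sum>\<tau>\<in>configs W. h (\<tau>(x := s)))"
    by (rule sum.cartesian_product[symmetric])
  also have "\<dots> = (\<Sum>\<tau>\<in>configs W. h (\<tau>(x := 1)) + h (\<tau>(x := -1)))"
    by (simp add: sum.distrib add.commute)
  finally show ?thesis .
qed

text \<open>Once the spin at \<open>x\<close> is fixed to \<open>s\<close>, each edge at
  \<open>x\<close> acts as an extra field on its other end. All inductions on the vertex set rest on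
  this.\<close>

lemma energy_insert:
  assumes "finite W" "x \<notin> W" and E: "\<And>e. e \<in> E \<Longrightarrow> card e = 2"
  shows "energy E J (insert x W) f (\<tau>(x := s))
    = s * f x + energy E J W (\<lambda>z. f z + s * edge_coupling E J x z) \<tau>"
proof -
  let ?A = "{e\<in>E. e \<subseteq> W}" and ?N = "{z\<in>W. {x, z} \<in> E}"
  have split: "{e\<in>E. e \<subseteq> insert x W} = ?A \<union> (\<lambda>z. {x, z}) ` ?N"
  proof (intro equalityI subsetI)
    fix e assume e: "e \<in> {e\<in>E. e \<subseteq> insert x W}"
    show "e \<in> ?A \<union> (\<lambda>z. {x, z}) ` ?N"
    proof (cases "x \<in> e")
      case True
      from e E have "card e = 2" by auto
      then obtain a b where ab: "e = {a, b}" "a \<noteq> b" by (auto simp: card_2_iff)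
      with True obtain z where "e = {x, z}" "z \<noteq> x" by auto
      with e show ?thesis by auto
    qed (use e in auto)
  qed auto
  have "(\<Sum>e\<in>{e\<in>E. e \<subseteq> insert x W}. J e * (\<Prod>y\<in>e. (\<tau>(x := s)) y))
      = (\<Sum>e\<in>?A. J e * (\<Prod>y\<in>e. (\<tau>(x := s)) y))
      + (\<Sum>e\<in>(\<lambda>z. {x, z}) ` ?N. J e * (\<Prod>y\<in>e. (\<tau>(x := s)) y))"
    unfolding split using assms by (intro sum.union_disjoint) auto
  also have "(\<Sum>e\<in>?A. J e * (\<Prod>y\<in>e. (\<tau>(x := s)) y)) = (\<Sum>e\<in>?A. J e * (\<Prod>y\<in>e. \<tau> y))"
    using assms(2) by (intro sum.cong refl arg_cong2[where f = "(*)"] prod.cong) auto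
  also have "(\<Sum>e\<in>(\<lambda>z. {x, z}) ` ?N. J e * (\<Prod>y\<in>e. (\<tau>(x := s)) y))
      = (\<Sum>z\<in>?N. J {x, z} * (\<Prod>y\<in>{x, z}. (\<tau>(x := s)) y))"
    using assms(2) by (subst sum.reindex) (auto simp: inj_on_def doubleton_eq_iff)
  also have "\<dots> = (\<Sum>z\<in>?N. s * edge_coupling E J x z * \<tau> z)"
  proof (intro sum.cong refl)
    fix z assume z: "z \<in> ?N"
    with assms(2) have "x \<noteq> z" by auto
    with z show "J {x, z} * (\<Prod>y\<in>{x, z}. (\<tau>(x := s)) y) = s * edge_coupling E J x z * \<tau> z"
      by (simp add: edge_coupling_def)
  qed
  also have "\<dots> = (\<Sum>z\<in>W. s * edge_coupling E J x z * \<tau> z)"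
    using assms(1) by (intro sum.mono_neutral_left) (auto simp: edge_coupling_def)
  finally have edges: "(\<Sum>e\<in>{e\<in>E. e \<subseteq> insert x W}. J e * (\<Prod>y\<in>e. (\<tau>(x := s)) y))
     = (\<Sum>e\<in>?A. J e * (\<Prod>y\<in>e. \<tau> y)) + (\<Sum>z\<in>W. s * edge_coupling E J x z * \<tau> z)" .
  have "(\<Sum>y\<in>insert x W. f y * (\<tau>(x := s)) y) = s * f x + (\<Sum>y\<in>W. f y * \<tau> y)"
  proof -
    have "(\<Sum>y\<in>W. f y * (\<tau>(x := s)) y) = (\<Sum>y\<in>W. f y * \<tau> y)"
      using assms(2) by (intro sum.cong) auto
    then show ?thesis using assms by simp
  qed
  with edges show ?thesis
    by (simp add: energy_def sum.distrib algebra_simps)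
qed

locale ising_couplings =
  fixes E :: "'a set set" and J :: "'a set \<Rightarrow> real"
  assumes edge_card: "\<And>e. e \<in> E \<Longrightarrow> card e = 2"
    and J_nonneg: "\<And>e. e \<in> E \<Longrightarrow> 0 \<le> J e"
begin

abbreviation c where "c \<equiv> edge_coupling E J"
abbreviation Z where "Z \<equiv> finite_field_Z E J"

lemma coupling_nonneg [simp]: "0 \<le> c x y"
  using J_nonneg by (simp add: edge_coupling_def)

lemma Z_insert:
  assumes "finite W" "x \<notin> W"
  shows "Z (insert x W) f
    = exp (f x) * Z W (\<lambda>z. f z + c x z) + exp (- f x) * Z W (\<lambda>z. f z - c x z)"
proof -
  have "exp (energy E J (insert x W) f (\<tau>(x := 1)))
      = exp (f x) * exp (energy E J W (\<lambda>z. f z + c x z) \<tau>)"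
    and "exp (energy E J (insert x W) f (\<tau>(x := -1)))
      = exp (- f x) * exp (energy E J W (\<lambda>z. f z - c x z) \<tau>)" for \<tau>
    by (simp_all add: energy_insert[OF assms edge_card] flip: exp_add)
  then show ?thesis
    by (simp add: finite_field_Z_def sum_configs_insert[OF assms] sum.distrib sum_distrib_left)
qed

lemma Z_empty [simp]: "Z {} f = 1"
proof -
  have "(\<Sum>e\<in>{e\<in>E. e = {}}. J e * (\<Prod>x\<in>e. \<sigma> x)) = 0" for \<sigma> :: "'a \<Rightarrow> real"
    using edge_card by (intro sum.neutral) fastforce
  then show ?thesis by (simp add: finite_field_Z_def configs_def energy_def)
qed

lemma Z_pos: "finite W \<Longrightarrow> 0 < Z W f"
  by (induction W arbitrary: f rule: finite_induct) (auto simp: Z_insert intro!: add_pos_pos)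

text \<open>Global spin flip: reversing the field exchanges the two terms of
  \<open>Z_insert\<close>.\<close>

lemma Z_uminus: "finite W \<Longrightarrow> Z W (\<lambda>z. - f z) = Z W f"
proof (induction W arbitrary: f rule: finite_induct)
  case (insert x W)
  then show ?case
    using insert.IH[of "\<lambda>z. f z - c x z"] insert.IH[of "\<lambda>z. f z + c x z"]
    by (simp add: Z_insert algebra_simps)
qed simp

lemma Z_cong: "(\<And>z. z \<in> W \<Longrightarrow> f z = f' z) \<Longrightarrow> Z W f = Z W f'"
  unfolding finite_field_Z_def energy_def by (metis (no_types, lifting) sum.cong)

text \<open>Log-supermodularity in the field, a form of the FKG inequality for ferromagnetic
  couplings. The induction follows the four functions theorem, comparing the contributions of the
  two spins at \<open>x\<close>.\<close>

lemma Z_supermodular: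
  assumes "finite W" "\<And>z. 0 \<le> s z" "\<And>z. 0 \<le> t z"
  shows "Z W (\<lambda>z. f z + s z) * Z W (\<lambda>z. f z + t z) \<le> Z W (\<lambda>z. f z + s z + t z) * Z W f"
  using assms
proof (induction W arbitrary: f s t rule: finite_induct)
  case (insert x W)
  note [simp] = Z_pos[OF insert.hyps(1)]
  \<comment> \<open>The letters A, B, C, D stand for the fields \<open>f + s + t\<close>,
    \<open>f\<close>, \<open>f + s\<close>, \<open>f + t\<close>; the digit 1 or 0 for spin 1 or -1
    at \<open>x\<close>.\<close>
  define A1 A0 B1 B0 C1 C0 D1 D0 where
    "A1 = exp (f x + s x + t x) * Z W (\<lambda>z. f z + s z + t z + c x z)"
    "A0 = exp (- (f x + s x + t x)) * Z W (\<lambda>z. f z + s z + t z - c x z)"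
    "B1 = exp (f x) * Z W (\<lambda>z. f z + c x z)"
    "B0 = exp (- f x) * Z W (\<lambda>z. f z - c x z)"
    "C1 = exp (f x + s x) * Z W (\<lambda>z. f z + s z + c x z)"
    "C0 = exp (- (f x + s x)) * Z W (\<lambda>z. f z + s z - c x z)"
    "D1 = exp (f x + t x) * Z W (\<lambda>z. f z + t z + c x z)"
    "D0 = exp (- (f x + t x)) * Z W (\<lambda>z. f z + t z - c x z)"
  note defs = this
  have pos: "0 < A1" "0 < A0" "0 < B1" "0 < B0" "0 < C1" "0 < C0" "0 < D1" "0 < D0"
    by (simp_all add: defs)
  have step: "exp a * y1 * (exp b * y2) \<le> exp a' * y3 * (exp b' * y4)"
    if "a + b \<le> a' + b'" "y1 * y2 \<le> y3 * y4" "0 < y1" "0 < y2" for a b a' b' y1 y2 y3 y4 :: real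
  proof -
    have "exp (a + b) * (y1 * y2) \<le> exp (a' + b') * (y3 * y4)"
      using that by (intro mult_mono[of "exp (a + b)"]) auto
    then show ?thesis by (simp add: exp_add mult_ac)
  qed
  have "C1 * D1 \<le> A1 * B1"
    unfolding defs using insert.IH[of s t "\<lambda>z. f z + c x z"] insert.prems
    by (intro step) (simp_all add: algebra_simps)
  moreover have "C0 * D0 \<le> A0 * B0"
    unfolding defs using insert.IH[of s t "\<lambda>z. f z - c x z"] insert.prems
    by (intro step) (simp_all add: algebra_simps)
  \<comment> \<open>For unequal spins at \<open>x\<close> the base field is \<open>f - c x\<close>,
    and the gap \<open>2 * c x\<close> is absorbed into one increment, which stays
    nonnegative.\<close>
  moreover have C1D0: "C1 * D0 \<le> A1 * B0"
    unfolding defs using insert.IH[of "\<lambda>z. s z + 2 * c x z" t "\<lambda>z. f z - c x z"] insert.prems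
    by (intro step) (simp_all add: algebra_simps)
  moreover have C0D1: "C0 * D1 \<le> A1 * B0"
    unfolding defs using insert.IH[of s "\<lambda>z. t z + 2 * c x z" "\<lambda>z. f z - c x z"] insert.prems
    by (intro step) (simp_all add: algebra_simps)
  moreover have "C1 * D0 + C0 * D1 \<le> A1 * B0 + A0 * B1"
  proof -
    have "(C1 * D0) * (C0 * D1) \<le> (A1 * B0) * (A0 * B1)"
      using mult_mono[OF \<open>C1 * D1 \<le> A1 * B1\<close> \<open>C0 * D0 \<le> A0 * B0\<close>] pos by (simp add: mult_ac)
    \<comment> \<open>Two numbers bounded by \<open>A1 * B0\<close>, with product at most
      \<open>(A1 * B0) * (A0 * B1)\<close>, have sum at most
      \<open>A1 * B0 + A0 * B1\<close>.\<close>
    moreover have "0 \<le> (A1 * B0 - C1 * D0) * (A1 * B0 - C0 * D1)"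
      using C1D0 C0D1 by simp
    ultimately have "(A1 * B0) * (C1 * D0 + C0 * D1) \<le> (A1 * B0) * (A1 * B0 + A0 * B1)"
      by (simp add: algebra_simps)
    then show ?thesis using pos by simp
  qed
  ultimately have "(C1 + C0) * (D1 + D0) \<le> (A1 + A0) * (B1 + B0)"
    by (simp add: algebra_simps)
  then show ?case
    using insert.hyps by (simp add: Z_insert defs)
qed simp

section \<open>The four-point inequality\<close>

text \<open>Two nested inductions: the outer one on \<open>card W\<close> gives the inequality for
  all fields on smaller sets; the inner one enlarges the set \<open>K\<close> where \<open>k\<close>
  is switched on. There \<open>g\<close> is arbitrary, since \<open>four_replica_edge\<close> needs
  every value of the field at the new site.\<close>

lemma four_point_inequality:
  assumes "finite W" "\<And>z. 0 \<le> k z" "\<And>z. 0 \<le> l z"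
  shows "Z W (\<lambda>z. g z + k z + l z) * Z W (\<lambda>z. g z - k z - l z) * (Z W (\<lambda>z. k z - l z))\<^sup>2
    \<le> Z W (\<lambda>z. g z + k z - l z) * Z W (\<lambda>z. g z - k z + l z) * (Z W (\<lambda>z. k z + l z))\<^sup>2"
  using assms
proof (induction "card W" arbitrary: W g k l rule: less_induct)
  case less
  note finW = less.prems(1) and k = less.prems(2) and l = less.prems(3)
  define kk where "kk = (\<lambda>K z. if z \<in> K then k z else 0)"
  have kk: "0 \<le> kk K z" for K z using k by (simp add: kk_def)
  have "Z W (\<lambda>z. g z + kk K z + l z) * Z W (\<lambda>z. g z - kk K z - l z) * (Z W (\<lambda>z. kk K z - l z))\<^sup>2
    \<le> Z W (\<lambda>z. g z + kk K z - l z) * Z W (\<lambda>z. g z - kk K z + l z) * (Z W (\<lambda>z. kk K z + l z))\<^sup>2"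
    if "finite K" "K \<subseteq> W" for K g
    using that
  proof (induction K arbitrary: g rule: finite_induct)
    \<comment> \<open>Without \<open>k\<close> the two sides agree, by spin-flip symmetry.\<close>
    case empty
    then show ?case using Z_uminus[OF finW, of l] by (simp add: kk_def mult_ac)
  next
    case (insert x K)
    define W' where "W' = W - {x}"
    have W: "W = insert x W'" "finite W'" "x \<notin> W'"
      using insert.prems finW by (auto simp: W'_def)
    then have card: "card W' < card W" by simp
    note [simp] = Z_pos[OF W(2)]
    have ZW: "Z W f = exp (f x) * Z W' (\<lambda>z. f z + c x z) + exp (- f x) * Z W' (\<lambda>z. f z - c x z)" for f
      unfolding W(1) by (rule Z_insert[OF W(2,3)])
    let ?k = "kk K" and ?k' = "kk (insert x K)"
    have kx: "?k x = 0" "?k' x = k x" using insert.hyps by (auto simp: kk_def)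
    have kW: "?k' z = ?k z" if "z \<in> W'" for z using that W by (auto simp: kk_def)
    define p1 q1 p2 q2 p3 q3 p4 q4 P Q P' Q' where
      "p1 = exp (g x + l x) * Z W' (\<lambda>z. g z + ?k z + l z + c x z)"
      "q1 = exp (- g x - l x) * Z W' (\<lambda>z. g z + ?k z + l z - c x z)"
      "p2 = exp (g x - l x) * Z W' (\<lambda>z. g z - ?k z - l z + c x z)"
      "q2 = exp (- g x + l x) * Z W' (\<lambda>z. g z - ?k z - l z - c x z)"
      "p3 = exp (g x - l x) * Z W' (\<lambda>z. g z + ?k z - l z + c x z)"
      "q3 = exp (- g x + l x) * Z W' (\<lambda>z. g z + ?k z - l z - c x z)"
      "p4 = exp (g x + l x) * Z W' (\<lambda>z. g z - ?k z + l z + c x z)"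
      "q4 = exp (- g x - l x) * Z W' (\<lambda>z. g z - ?k z + l z - c x z)"
      "P = exp (l x) * Z W' (\<lambda>z. ?k z + l z + c x z)"
      "Q = exp (- l x) * Z W' (\<lambda>z. ?k z + l z - c x z)"
      "P' = exp (- l x) * Z W' (\<lambda>z. ?k z - l z + c x z)"
      "Q' = exp (l x) * Z W' (\<lambda>z. ?k z - l z - c x z)"
    note defs = this
    have pos: "0 < p1" "0 < q1" "0 < p2" "0 < q2" "0 < p3" "0 < q3" "0 < p4" "0 < q4"
      "0 < P" "0 < Q" "0 < P'" "0 < Q'"
      by (simp_all add: defs)
    have base: "(\<alpha> * p1 + \<beta> * q1) * (\<alpha> * p2 + \<beta> * q2) * (P' + Q')\<^sup>2
      \<le> (\<alpha> * p3 + \<beta> * q3) * (\<alpha> * p4 + \<beta> * q4) * (P + Q)\<^sup>2"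
      if "0 < \<alpha>" "0 < \<beta>" for \<alpha> \<beta>
    proof -
      \<comment> \<open>Adding \<open>t\<close> to the field at \<open>x\<close> weights the two
        spins by \<open>exp t\<close> and \<open>exp (- t)\<close>, whose ratio is
        \<open>\<alpha> / \<beta>\<close>; multiplying by \<open>\<alpha> * \<beta>\<close> restores
        the weights \<open>\<alpha>\<close> and \<open>\<beta>\<close>.\<close>
      define t where "t = ln (\<alpha> / \<beta>) / 2"
      define h where "h = g(x := g x + t)"
      have hx: "h x = g x + t" by (simp add: h_def)
      have hW: "h z = g z" if "z \<in> W'" for z using that W by (auto simp: h_def)
      have Zh: "Z W (\<lambda>z. h z + ?k z + l z) = exp t * p1 + exp (- t) * q1"
        "Z W (\<lambda>z. h z - ?k z - l z) = exp t * p2 + exp (- t) * q2"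
        "Z W (\<lambda>z. h z + ?k z - l z) = exp t * p3 + exp (- t) * q3"
        "Z W (\<lambda>z. h z - ?k z + l z) = exp t * p4 + exp (- t) * q4"
        unfolding defs ZW
        by (simp_all add: hW hx kx exp_add exp_diff exp_minus field_simps cong: Z_cong)
      have Z0: "Z W (\<lambda>z. ?k z - l z) = P' + Q'" "Z W (\<lambda>z. ?k z + l z) = P + Q"
        unfolding defs ZW by (simp_all add: kx)
      have "(exp t * p1 + exp (- t) * q1) * (exp t * p2 + exp (- t) * q2) * (P' + Q')\<^sup>2
         \<le> (exp t * p3 + exp (- t) * q3) * (exp t * p4 + exp (- t) * q4) * (P + Q)\<^sup>2"
        using insert.IH[of h] insert.prems unfolding Zh Z0 by simp
      then have "(\<alpha> * \<beta>) * ((exp t * p1 + exp (- t) * q1) * (exp t * p2 + exp (- t) * q2) * (P' + Q')\<^sup>2)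
         \<le> (\<alpha> * \<beta>) * ((exp t * p3 + exp (- t) * q3) * (exp t * p4 + exp (- t) * q4) * (P + Q)\<^sup>2)"
        using that by (intro mult_left_mono) auto
      moreover have "(\<alpha> * \<beta>) * ((exp t * a + exp (- t) * b) * (exp t * a' + exp (- t) * b'))
          = (\<alpha> * a + \<beta> * b) * (\<alpha> * a' + \<beta> * b')" for a b a' b'
      proof -
        have e: "exp t * exp t = \<alpha> / \<beta>" "exp (- t) * exp (- t) = \<beta> / \<alpha>" "exp t * exp (- t) = 1"
        proof -
          show "exp t * exp t = \<alpha> / \<beta>" using that by (simp add: t_def flip: exp_add)
          then have "inverse (exp t * exp t) = \<beta> / \<alpha>" by simp
          then show "exp (- t) * exp (- t) = \<beta> / \<alpha>" by (simp add: exp_minus)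
        qed (simp flip: exp_add)
        have "(exp t * a + exp (- t) * b) * (exp t * a' + exp (- t) * b')
          = (exp t * exp t) * (a * a') + (exp t * exp (- t)) * (a * b' + b * a')
            + (exp (- t) * exp (- t)) * (b * b')"
          by (simp add: algebra_simps)
        also have "(\<alpha> * \<beta>) * \<dots> = (\<alpha> * a + \<beta> * b) * (\<alpha> * a' + \<beta> * b')"
          unfolding e using that by (simp add: field_simps)
        finally show ?thesis .
      qed
      ultimately show ?thesis by (simp only: mult.assoc[symmetric])
    qed
    have cancel: "exp a * y1 * (exp b * y2) * (exp d * y3)\<^sup>2 \<le> exp a' * y4 * (exp b' * y5) * (exp d' * y6)\<^sup>2"
      if "y1 * y2 * y3\<^sup>2 \<le> y4 * y5 * y6\<^sup>2" "a + b + 2 * d = a' + b' + 2 * d'"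
      for a b d a' b' d' y1 y2 y3 y4 y5 y6 :: real
    proof -
      have "exp (a + b + 2 * d) * (y1 * y2 * y3\<^sup>2) \<le> exp (a' + b' + 2 * d') * (y4 * y5 * y6\<^sup>2)"
        unfolding that(2) using that(1) by (intro mult_left_mono) auto
      moreover have "exp (x + y + 2 * z) = exp x * exp y * (exp z)\<^sup>2" for x y z :: real
        by (simp add: exp_add exp_double)
      ultimately show ?thesis
        by (simp add: power_mult_distrib mult_ac)
    qed
    \<comment> \<open>In \<open>AB\<close> and \<open>AD\<close> the exponential prefactors multiply
      to 1 on both sides, leaving the outer induction hypothesis on \<open>W'\<close>.\<close>
    have AB: "p1 * q2 * P'\<^sup>2 \<le> p3 * q4 * P\<^sup>2"
      unfolding defs
      using less.hyps[OF card W(2), of "\<lambda>z. ?k z + c x z" l g] kk l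
      by (intro cancel) (simp_all add: algebra_simps)
    have AD: "p1 * q2 * Q\<^sup>2 \<le> q1 * p2 * P\<^sup>2"
      unfolding defs
      using less.hyps[OF card W(2), of "\<lambda>z. ?k z + l z" "c x" g] kk l
      by (intro cancel) (simp_all add: algebra_simps)
    \<comment> \<open>Supermodularity from the base field \<open>k - l - c x\<close> (with
      \<open>k\<close> restricted to \<open>K\<close>) with increments \<open>2 * l\<close> and
      \<open>2 * c x\<close>.\<close>
    have PQ: "Q * P' \<le> P * Q'"
    proof -
      have "Z W' (\<lambda>z. ?k z + l z - c x z) * Z W' (\<lambda>z. ?k z - l z + c x z)
         \<le> Z W' (\<lambda>z. ?k z + l z + c x z) * Z W' (\<lambda>z. ?k z - l z - c x z)"
        using Z_supermodular[OF W(2), of "\<lambda>z. 2 * l z" "\<lambda>z. 2 * c x z" "\<lambda>z. ?k z - l z - c x z"] l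
        by (simp add: algebra_simps)
      moreover have "exp (- 2 * l x) \<le> exp (2 * l x)" using l by simp
      ultimately have "exp (- 2 * l x) * (Z W' (\<lambda>z. ?k z + l z - c x z) * Z W' (\<lambda>z. ?k z - l z + c x z))
         \<le> exp (2 * l x) * (Z W' (\<lambda>z. ?k z + l z + c x z) * Z W' (\<lambda>z. ?k z - l z - c x z))"
        by - (rule mult_mono; simp add: less_imp_le)
      moreover have "exp (- 2 * l x) = exp (- l x) * exp (- l x)" "exp (2 * l x) = exp (l x) * exp (l x)"
        by (simp_all flip: exp_add)
      ultimately show ?thesis by (simp add: defs mult_ac)
    qed
    define a where "a = exp (k x)"
    have a: "0 < a" "1 \<le> a" "1 \<le> a\<^sup>2" using k by (simp_all add: a_def one_le_power)
    \<comment> \<open>Switching on \<open>k x\<close> weights the spins at \<open>x\<close> by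
      \<open>a\<close> and \<open>1 / a\<close>. Pulling out \<open>1 / a\<close> leaves
      \<open>\<kappa> = a\<^sup>2\<close>, and both sides of the claim carry the same factor
      \<open>1 / a ^ 4\<close>.\<close>
    have Z1: "Z W (\<lambda>z. g z + ?k' z + l z) = (a\<^sup>2 * p1 + q1) / a"
      "Z W (\<lambda>z. g z - ?k' z - l z) = (p2 + a\<^sup>2 * q2) / a"
      "Z W (\<lambda>z. g z + ?k' z - l z) = (a\<^sup>2 * p3 + q3) / a"
      "Z W (\<lambda>z. g z - ?k' z + l z) = (p4 + a\<^sup>2 * q4) / a"
      "Z W (\<lambda>z. ?k' z - l z) = (a\<^sup>2 * P' + Q') / a"
      "Z W (\<lambda>z. ?k' z + l z) = (a\<^sup>2 * P + Q) / a"
      unfolding defs ZW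
      by (simp_all add: kW kx a_def exp_add exp_diff exp_minus power2_eq_square field_simps cong: Z_cong)
    have "(a\<^sup>2 * p1 + q1) * (p2 + a\<^sup>2 * q2) * (a\<^sup>2 * P' + Q')\<^sup>2
       \<le> (a\<^sup>2 * p3 + q3) * (p4 + a\<^sup>2 * q4) * (a\<^sup>2 * P + Q)\<^sup>2"
      by (intro four_replica_edge pos base AB AD PQ a)
    then have "(a\<^sup>2 * p1 + q1) * (p2 + a\<^sup>2 * q2) * (a\<^sup>2 * P' + Q')\<^sup>2 / a ^ 4
       \<le> (a\<^sup>2 * p3 + q3) * (p4 + a\<^sup>2 * q4) * (a\<^sup>2 * P + Q)\<^sup>2 / a ^ 4"
      using a by (intro divide_right_mono) auto
    then show ?case
      unfolding Z1 by (simp add: power_divide power2_eq_square power4_eq_xxxx)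
  qed
  from this[OF finW subset_refl]
  have "Z W (\<lambda>z. g z + kk W z + l z) * Z W (\<lambda>z. g z - kk W z - l z) * (Z W (\<lambda>z. kk W z - l z))\<^sup>2
    \<le> Z W (\<lambda>z. g z + kk W z - l z) * Z W (\<lambda>z. g z - kk W z + l z) * (Z W (\<lambda>z. kk W z + l z))\<^sup>2" .
  moreover have "Z W (\<lambda>z. F z (kk W z)) = Z W (\<lambda>z. F z (k z))" for F
    by (rule Z_cong) (simp add: kk_def)
  note this[of "\<lambda>z y. g z + y + l z"] this[of "\<lambda>z y. g z - y - l z"] this[of "\<lambda>z y. y - l z"]
    this[of "\<lambda>z y. g z + y - l z"] this[of "\<lambda>z y. g z - y + l z"] this[of "\<lambda>z y. y + l z"]
  ultimately show ?case by simp
qed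

section \<open>From the four-point inequality to truncated correlations\<close>

lemma two_spin_sum:
  fixes f :: "'a \<Rightarrow> real"
  assumes "finite W" "u \<notin> W" "v \<notin> W" "u \<noteq> v"
  defines "y \<equiv> \<lambda>a b. exp (a * f u + b * f v + a * b * c u v)
      * Z W (\<lambda>z. f z + a * c u z + b * c v z)"
  shows "(\<Sum>\<sigma>\<in>configs (insert u (insert v W)). exp (energy E J (insert u (insert v W)) f \<sigma>) * \<phi> (\<sigma> u) (\<sigma> v))
    = \<phi> 1 1 * y 1 1 + \<phi> 1 (-1) * y 1 (-1) + \<phi> (-1) 1 * y (-1) 1 + \<phi> (-1) (-1) * y (-1) (-1)"
proof -
  have fin: "finite (insert v W)" "u \<notin> insert v W" using assms by auto
  have e: "exp (energy E J (insert u (insert v W)) f (\<tau>(v := b, u := a)))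
     = exp (a * f u + b * f v + a * b * c u v) * exp (energy E J W (\<lambda>z. f z + a * c u z + b * c v z) \<tau>)"
    for a b \<tau>
    by (simp add: energy_insert[OF fin edge_card] energy_insert[OF assms(1,3) edge_card] algebra_simps
        flip: exp_add)
  have "(\<Sum>\<tau>\<in>configs W. exp (energy E J (insert u (insert v W)) f (\<tau>(v := b, u := a)))
      * \<phi> ((\<tau>(v := b, u := a)) u) ((\<tau>(v := b, u := a)) v)) = \<phi> a b * y a b" for a b
    using assms(4) unfolding e
    by (simp add: y_def finite_field_Z_def sum_distrib_left sum_distrib_right mult_ac)
  then show ?thesis
    by (simp only: sum_configs_insert[OF fin] sum_configs_insert[OF assms(1,3)] sum.distrib add.assoc)
qed

definition mean :: "'a set \<Rightarrow> ('a \<Rightarrow> real) \<Rightarrow> (('a \<Rightarrow> real) \<Rightarrow> real) \<Rightarrow> real" where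
  "mean V f X = (\<Sum>\<sigma>\<in>configs V. exp (energy E J V f \<sigma>) * X \<sigma>) / Z V f"

text \<open>With \<open>a, b, x, y\<close> the weights of the spin pairs ++, --, +-, -+ and
  \<open>S\<close> their sum, the covariance is \<open>4 * (a * b - x * y) / S\<^sup>2\<close>. By
  AM-GM, \<open>S\<close> is at least twice \<open>sqrt (a * b) + sqrt (x * y)\<close>, and the
  four-point inequality compares the resulting quotient with the zero-field one.\<close>

lemma truncated_le_zero_field:
  assumes "finite V" "u \<in> V" "v \<in> V" "u \<noteq> v"
  shows "mean V f (\<lambda>\<sigma>. \<sigma> u * \<sigma> v) - mean V f (\<lambda>\<sigma>. \<sigma> u) * mean V f (\<lambda>\<sigma>. \<sigma> v)
    \<le> mean V (\<lambda>_. 0) (\<lambda>\<sigma>. \<sigma> u * \<sigma> v)"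
proof -
  define W where "W = V - {u, v}"
  have V: "V = insert u (insert v W)" and W: "finite W" "u \<notin> W" "v \<notin> W"
    using assms by (auto simp: W_def)
  note two = two_spin_sum[OF W assms(4)]
  note [simp] = Z_pos[OF W(1)]
  define a b x y where
    "a = exp (f u + f v + c u v) * Z W (\<lambda>z. f z + c u z + c v z)"
    "b = exp (- f u - f v + c u v) * Z W (\<lambda>z. f z - c u z - c v z)"
    "x = exp (f u - f v - c u v) * Z W (\<lambda>z. f z + c u z - c v z)"
    "y = exp (- f u + f v - c u v) * Z W (\<lambda>z. f z - c u z + c v z)"
  note defs = this
  \<comment> \<open>In zero field the spin flip makes ++ and -- equally heavy, and likewise +- and
    -+, so two weights suffice.\<close>
  define a0 x0 where
    "a0 = exp (c u v) * Z W (\<lambda>z. c u z + c v z)"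
    "x0 = exp (- c u v) * Z W (\<lambda>z. c u z - c v z)"
  note defs0 = this
  have pos: "0 < a" "0 < b" "0 < x" "0 < y" "0 < a0" "0 < x0" by (simp_all add: defs defs0)
  have m: "mean V f (\<lambda>\<sigma>. \<phi> (\<sigma> u) (\<sigma> v))
    = (\<phi> 1 1 * a + \<phi> 1 (-1) * x + \<phi> (-1) 1 * y + \<phi> (-1) (-1) * b) / (a + x + y + b)" for \<phi>
    using two[where f = f and \<phi> = \<phi>] two[where f = f and \<phi> = "\<lambda>_ _. 1"]
    unfolding mean_def finite_field_Z_def[of _ _ V] by (simp add: defs flip: V)
  have flip: "Z W (\<lambda>z. - c u z - c v z) = Z W (\<lambda>z. c u z + c v z)"
    "Z W (\<lambda>z. c v z - c u z) = Z W (\<lambda>z. c u z - c v z)"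
    using Z_uminus[OF W(1), of "\<lambda>z. c u z + c v z"] Z_uminus[OF W(1), of "\<lambda>z. c u z - c v z"]
    by (simp_all add: algebra_simps)
  have m0: "mean V (\<lambda>_. 0) (\<lambda>\<sigma>. \<sigma> u * \<sigma> v) = (2 * a0 - 2 * x0) / (2 * a0 + 2 * x0)"
    using two[where f = "\<lambda>_. 0" and \<phi> = "\<lambda>s t. s * t"] two[where f = "\<lambda>_. 0" and \<phi> = "\<lambda>_ _. 1"]
    unfolding mean_def finite_field_Z_def[of _ _ V] by (simp add: defs0 flip flip: V)
  \<comment> \<open>The coupling between \<open>u\<close> and \<open>v\<close> contributes factors
    that cancel on each side.\<close>
  have key: "a * b * x0\<^sup>2 \<le> x * y * a0\<^sup>2"
  proof -
    have "a * b * x0\<^sup>2 = Z W (\<lambda>z. f z + c u z + c v z) * Z W (\<lambda>z. f z - c u z - c v z)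
        * (Z W (\<lambda>z. c u z - c v z))\<^sup>2"
      by (simp add: defs defs0 power2_eq_square exp_add exp_diff exp_minus field_simps)
    also have "\<dots> \<le> Z W (\<lambda>z. f z + c u z - c v z) * Z W (\<lambda>z. f z - c u z + c v z)
        * (Z W (\<lambda>z. c u z + c v z))\<^sup>2"
      by (intro four_point_inequality W) auto
    also have "\<dots> = x * y * a0\<^sup>2"
      by (simp add: defs defs0 power2_eq_square exp_add exp_diff exp_minus field_simps)
    finally show ?thesis .
  qed
  \<comment> \<open>This makes the zero-field correlation nonnegative, which settles the case of
    nonpositive covariance.\<close>
  have x0a0: "x0 \<le> a0"
  proof -
    have "(Z W (\<lambda>z. c u z - c v z))\<^sup>2 \<le> (Z W (\<lambda>z. c u z + c v z))\<^sup>2"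
      using Z_supermodular[OF W(1), of "\<lambda>z. 2 * c u z" "\<lambda>z. 2 * c v z" "\<lambda>z. - c u z - c v z"] flip
      by (simp add: power2_eq_square algebra_simps)
    then have "Z W (\<lambda>z. c u z - c v z) \<le> Z W (\<lambda>z. c u z + c v z)"
      by (rule power2_le_imp_le) (simp add: less_imp_le)
    moreover have "exp (- c u v) \<le> exp (c u v)" using coupling_nonneg[of u v] by simp
    ultimately show ?thesis unfolding defs0 by (intro mult_mono) (simp_all add: less_imp_le)
  qed
  define S where "S = a + x + y + b"
  have S: "0 < S" using pos by (simp add: S_def)
  have "mean V f (\<lambda>\<sigma>. \<sigma> u * \<sigma> v) - mean V f (\<lambda>\<sigma>. \<sigma> u) * mean V f (\<lambda>\<sigma>. \<sigma> v)
    = (a - x - y + b) / S - (a + x - y - b) / S * ((a - x + y - b) / S)"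
    using m[of "\<lambda>s t. s * t"] m[of "\<lambda>s t. s"] m[of "\<lambda>s t. t"] by (simp add: S_def)
  also have "\<dots> = ((a - x - y + b) * S - (a + x - y - b) * (a - x + y - b)) / S\<^sup>2"
    using S by (simp add: field_simps power2_eq_square)
  also have "(a - x - y + b) * S - (a + x - y - b) * (a - x + y - b) = 4 * (a * b - x * y)"
    by (simp add: S_def algebra_simps)
  also have "4 * (a * b - x * y) / S\<^sup>2 \<le> (2 * a0 - 2 * x0) / (2 * a0 + 2 * x0)"
  proof (cases "a * b \<le> x * y")
    case True
    then have "4 * (a * b - x * y) / S\<^sup>2 \<le> 0" by (simp add: divide_nonpos_nonneg)
    also have "0 \<le> (2 * a0 - 2 * x0) / (2 * a0 + 2 * x0)" using x0a0 pos by simp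
    finally show ?thesis .
  next
    case False
    define A X where "A = sqrt (a * b)" "X = sqrt (x * y)"
    have AX: "A\<^sup>2 = a * b" "X\<^sup>2 = x * y" "0 < A" "0 < X"
      using pos by (simp_all add: A_X_def)
    have "A \<le> (a + b) / 2" "X \<le> (x + y) / 2"
      using pos arith_geo_mean_sqrt[of a b] arith_geo_mean_sqrt[of x y] by (simp_all add: A_X_def)
    then have "2 * (A + X) \<le> S" by (simp add: S_def)
    then have "(2 * (A + X))\<^sup>2 \<le> S\<^sup>2" using AX by (intro power_mono) auto
    then have "4 * (a * b - x * y) / S\<^sup>2 \<le> 4 * (a * b - x * y) / (2 * (A + X))\<^sup>2"
      using False AX S by (intro divide_left_mono mult_pos_pos) auto
    also have "\<dots> = (A - X) / (A + X)"
    proof -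
      have "4 * (a * b - x * y) = 4 * ((A - X) * (A + X))"
        by (simp add: AX(1,2)[symmetric] power2_eq_square algebra_simps)
      moreover have "4 * (d * T) / (2 * T)\<^sup>2 = d / T" if "0 < T" for d T :: real
        using that by (simp add: divide_simps power2_eq_square)
      ultimately show ?thesis using AX by (simp only: add_pos_pos)
    qed
    also have "\<dots> \<le> (2 * a0 - 2 * x0) / (2 * a0 + 2 * x0)"
    proof -
      have "(A * x0)\<^sup>2 \<le> (X * a0)\<^sup>2" using key AX by (simp add: power_mult_distrib)
      then have "A * x0 \<le> X * a0" by (rule power2_le_imp_le) (use pos AX in simp)
      then show ?thesis using pos AX by (simp add: divide_simps add_pos_pos) (simp add: algebra_simps)
    qed
    finally show ?thesis .
  qed
  finally show ?thesis by (simp add: m0)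
qed

end

section \<open>Infinite fields as limits, and the conclusion\<close>

definition field_truncation :: "('a \<Rightarrow> ereal) \<Rightarrow> nat \<Rightarrow> 'a \<Rightarrow> real" where
  "field_truncation g n x =
    (if g x = \<infinity> then real n else if g x = -\<infinity> then - real n else real_of_ereal (g x))"

text \<open>After renormalisation, a vertex with infinite field contributes 1 if its spin obeys the
  constraint and \<open>exp (- 2 * n)\<close> otherwise, so exactly the admissible configurations
  survive.\<close>

lemma tendsto_truncated_weight:
  assumes V: "finite V" and E: "\<And>e. e \<in> E \<Longrightarrow> e \<subseteq> V" and \<sigma>: "\<sigma> \<in> configs V"
  shows "(\<lambda>n. exp (energy E J V (field_truncation g n) \<sigma>) * exp (- real n * real (card {x\<in>V. \<bar>g x\<bar> = \<infinity>})))
    \<longlonglongrightarrow> ising_weight V E J g \<sigma>"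
proof -
  let ?I = "{x\<in>V. \<bar>g x\<bar> = \<infinity>}"
  define s where "s x = (if g x = \<infinity> then 1 else -1 :: real)" for x
  have \<sigma>_val: "\<sigma> x = 1 \<or> \<sigma> x = -1" if "x \<in> V" for x
    using \<sigma> that by (auto simp: configs_def)
  have EV: "{e\<in>E. e \<subseteq> V} = E" using E by auto
  have weight: "exp (energy E J V (field_truncation g n) \<sigma>) * exp (- real n * real (card ?I))
    = exp (ising_exponent V E J g \<sigma>) * (\<Prod>x\<in>?I. exp (real n * (s x * \<sigma> x - 1)))" for n
  proof -
    have "(\<Sum>x\<in>V. field_truncation g n x * \<sigma> x)
      = (\<Sum>x\<in>{x\<in>V. \<bar>g x\<bar> \<noteq> \<infinity>}. field_truncation g n x * \<sigma> x) + (\<Sum>x\<in>?I. field_truncation g n x * \<sigma> x)"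
    proof -
      have "{x\<in>V. \<bar>g x\<bar> \<noteq> \<infinity>} \<union> ?I = V" by auto
      then show ?thesis
        using V sum.union_disjoint[of "{x\<in>V. \<bar>g x\<bar> \<noteq> \<infinity>}" ?I "\<lambda>x. field_truncation g n x * \<sigma> x"]
        by (metis (mono_tags, lifting) disjoint_iff finite_Un mem_Collect_eq)
    qed
    also have "(\<Sum>x\<in>{x\<in>V. \<bar>g x\<bar> \<noteq> \<infinity>}. field_truncation g n x * \<sigma> x)
      = (\<Sum>x\<in>{x\<in>V. \<bar>g x\<bar> \<noteq> \<infinity>}. real_of_ereal (g x) * \<sigma> x)"
      by (intro sum.cong refl) (auto simp: field_truncation_def)
    also have "(\<Sum>x\<in>?I. field_truncation g n x * \<sigma> x) = (\<Sum>x\<in>?I. real n * (s x * \<sigma> x))"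
      by (intro sum.cong refl) (auto simp: field_truncation_def s_def)
    finally have "energy E J V (field_truncation g n) \<sigma> - real n * real (card ?I)
      = ising_exponent V E J g \<sigma> + (\<Sum>x\<in>?I. real n * (s x * \<sigma> x - 1))"
      by (simp add: energy_def ising_exponent_def EV right_diff_distrib sum_subtractf)
    moreover have "exp (energy E J V (field_truncation g n) \<sigma>) * exp (- real n * real (card ?I))
      = exp (energy E J V (field_truncation g n) \<sigma> - real n * real (card ?I))"
      by (simp flip: exp_add)
    ultimately show ?thesis
      using V by (simp add: exp_add exp_sum)
  qed
  have "(\<lambda>n. exp (real n * (s x * \<sigma> x - 1))) \<longlonglongrightarrow> (if \<sigma> x = s x then 1 else 0)" if "x \<in> ?I" for x
  proof (cases "\<sigma> x = s x")
    case True
    then have "s x * \<sigma> x - 1 = 0" by (simp add: s_def)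
    with True show ?thesis by simp
  next
    case False
    then have eq: "s x * \<sigma> x - 1 = -2" using \<sigma>_val[of x] that by (auto simp: s_def split: if_splits)
    have "(\<lambda>n. exp (real n * (s x * \<sigma> x - 1))) \<longlonglongrightarrow> 0" unfolding eq by real_asymp
    with False show ?thesis by simp
  qed
  then have "(\<lambda>n. exp (ising_exponent V E J g \<sigma>) * (\<Prod>x\<in>?I. exp (real n * (s x * \<sigma> x - 1))))
    \<longlonglongrightarrow> exp (ising_exponent V E J g \<sigma>) * (\<Prod>x\<in>?I. if \<sigma> x = s x then 1 else 0)"
    by (intro tendsto_mult_left tendsto_prod)
  also have "exp (ising_exponent V E J g \<sigma>) * (\<Prod>x\<in>?I. if \<sigma> x = s x then 1 else 0)
    = ising_weight V E J g \<sigma>"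
  proof -
    have adm: "admissible V g \<sigma> \<longleftrightarrow> (\<forall>x\<in>?I. \<sigma> x = s x)"
      by (auto simp: admissible_def s_def)
    have ind: "(\<Prod>x\<in>I. if \<sigma> x = s x then 1 else 0 :: real) = (if \<forall>x\<in>I. \<sigma> x = s x then 1 else 0)"
      if "finite I" for I
      using that by (induction I) auto
    have "(\<Prod>x\<in>?I. if \<sigma> x = s x then 1 else 0 :: real) = (if admissible V g \<sigma> then 1 else 0)"
      unfolding adm by (rule ind[OF finite_subset[OF Collect_restrict V]])
    then show ?thesis by (cases "admissible V g \<sigma>")
        (simp_all only: ising_weight_def if_True if_False mult_1_right mult_zero_right)
  qed
  finally show ?thesis by (simp only: weight)
qed

context ising_couplings
begin

text \<open>The renormalising factor does not depend on the configuration and cancels in the mean;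
  the limiting denominator is the positive partition function.\<close>

lemma tendsto_truncated_mean:
  assumes "finite V" "\<And>e. e \<in> E \<Longrightarrow> e \<subseteq> V"
  shows "(\<lambda>n. mean V (field_truncation g n) X) \<longlonglongrightarrow> ising_expectation V E J g X"
proof -
  define r where "r n = exp (- real n * real (card {x\<in>V. \<bar>g x\<bar> = \<infinity>}))" for n
  have "(\<lambda>n. (\<Sum>\<sigma>\<in>configs V. exp (energy E J V (field_truncation g n) \<sigma>) * r n * X \<sigma>)
      / (\<Sum>\<sigma>\<in>configs V. exp (energy E J V (field_truncation g n) \<sigma>) * r n))
    \<longlonglongrightarrow> (\<Sum>\<sigma>\<in>configs V. ising_weight V E J g \<sigma> * X \<sigma>) / (\<Sum>\<sigma>\<in>configs V. ising_weight V E J g \<sigma>)"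
    unfolding r_def
    using partition_function_pos[OF assms(1), of E J g]
    by (intro tendsto_intros tendsto_truncated_weight assms) (auto simp: partition_function_def)
  moreover have "(\<Sum>\<sigma>\<in>configs V. exp (energy E J V (field_truncation g n) \<sigma>) * r n * X \<sigma>)
      / (\<Sum>\<sigma>\<in>configs V. exp (energy E J V (field_truncation g n) \<sigma>) * r n)
      = mean V (field_truncation g n) X" for n
  proof -
    have "r n \<noteq> 0" by (simp add: r_def)
    moreover have "(\<Sum>\<sigma>\<in>configs V. exp (energy E J V (field_truncation g n) \<sigma>) * r n * X \<sigma>)
      = r n * (\<Sum>\<sigma>\<in>configs V. exp (energy E J V (field_truncation g n) \<sigma>) * X \<sigma>)"
      "(\<Sum>\<sigma>\<in>configs V. exp (energy E J V (field_truncation g n) \<sigma>) * r n)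
      = r n * Z V (field_truncation g n)"
      by (simp_all add: finite_field_Z_def sum_distrib_left mult_ac)
    ultimately show ?thesis by (simp add: mean_def)
  qed
  ultimately show ?thesis
    by (simp add: ising_expectation_eq_sum[OF assms(1)] partition_function_def)
qed

end

theorem corollary1p3:
  fixes V :: "'a set" and E :: "'a set set" and J :: "'a set \<Rightarrow> real"
    and g :: "'a \<Rightarrow> ereal" and u v :: 'a
  assumes "finite_simple_graph V E"
    and "\<And>e. e \<in> E \<Longrightarrow> 0 \<le> J e"
    and "u \<in> V" and "v \<in> V"
  shows "ising_expectation V E J g (\<lambda>\<sigma>. \<sigma> u * \<sigma> v)
       - ising_expectation V E J g (\<lambda>\<sigma>. \<sigma> u) * ising_expectation V E J g (\<lambda>\<sigma>. \<sigma> v)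
     \<le> ising_expectation V E J (\<lambda>_. 0) (\<lambda>\<sigma>. \<sigma> u * \<sigma> v)"
proof -
  from assms(1) have V: "finite V" and E: "\<And>e. e \<in> E \<Longrightarrow> e \<subseteq> V" "\<And>e. e \<in> E \<Longrightarrow> card e = 2"
    by (auto simp: finite_simple_graph_def)
  interpret ising_couplings E J
    using E assms(2) by unfold_locales
  show ?thesis
  proof (cases "u = v")
    \<comment> \<open>On the diagonal the right side is 1 and the left side is 1 minus a
      square.\<close>
    case True
    have "ising_expectation V E J f (\<lambda>\<sigma>. \<sigma> v * \<sigma> v) = 1" for f
    proof -
      have "\<sigma> v * \<sigma> v = 1" if "\<sigma> \<in> configs V" for \<sigma> :: "'a \<Rightarrow> real"
        using that assms(4) by (auto simp: configs_def PiE_iff)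
      then show ?thesis
        using partition_function_pos[OF V, of E J f]
        by (simp add: ising_expectation_eq_sum[OF V] partition_function_def)
    qed
    with True show ?thesis by simp
  next
    case False
    \<comment> \<open>Truncation does not change the zero field, so the limit theorem applied to a
      constant sequence identifies the two expectations.\<close>
    have zero: "ising_expectation V E J (\<lambda>_. 0) X = mean V (\<lambda>_. 0) X" for X
    proof (rule LIMSEQ_unique[OF tendsto_truncated_mean[OF V E(1)]])
      have "field_truncation (\<lambda>_ :: 'a. 0) n = (\<lambda>_. 0)" for n
        by (simp add: field_truncation_def fun_eq_iff)
      then show "(\<lambda>n. mean V (field_truncation (\<lambda>_. 0) n) X) \<longlonglongrightarrow> mean V (\<lambda>_. 0) X"
        by simp
    qed
    show ?thesis
      unfolding zero
    proof (rule LIMSEQ_le_const2)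
      show "(\<lambda>n. mean V (field_truncation g n) (\<lambda>\<sigma>. \<sigma> u * \<sigma> v)
          - mean V (field_truncation g n) (\<lambda>\<sigma>. \<sigma> u) * mean V (field_truncation g n) (\<lambda>\<sigma>. \<sigma> v))
        \<longlonglongrightarrow> ising_expectation V E J g (\<lambda>\<sigma>. \<sigma> u * \<sigma> v)
          - ising_expectation V E J g (\<lambda>\<sigma>. \<sigma> u) * ising_expectation V E J g (\<lambda>\<sigma>. \<sigma> v)"
        by (intro tendsto_intros tendsto_truncated_mean V E)
    qed (use truncated_le_zero_field[OF V assms(3,4) False] in auto)
  qed
qed

end
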